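(* Let $n,d\ge 1$ and let $\Delta\in\mathbb{R}^{nd\times nd}$ be a symmetric matrix with $d\times d$ blocks $\Delta_{ij}$ (so $\Delta_{ji}=\Delta_{ij}^{\top}$) and $\Delta_{ii}=0$. Let $Z\in\mathbb{R}^{nd\times d}$ with $Z^{\top}=[I_d,\dots,I_d]$ and $A=ZZ^{\top}+\Delta$, i.e. $A_{ij}=I_d+\Delta_{ij}$. For $1\le i\le n$ let $\Delta_i^{\top}=[\Delta_{i1},\dots,\Delta_{in}]\in\mathbb{R}^{d\times nd}$ be the $i$-th block row of $\Delta$, so that $\Delta_i^{\top}Z=\sum_{j=1}^n\Delta_{ij}$. Suppose that, with $\delta=4$, \[ n\ \ge\ \frac{3\delta^2 d\|\Delta\|_{\mathrm{op}}^2}{2n}+\delta\sqrt{\frac{d}{n}}\,\|\Delta\|_{\mathrm{op}}\max_{1\le i\le n}\|\Delta_i\|_{\mathrm{op}}+\max_{1\le i\le n}\|\Delta_i^{\top}Z\|_{\mathrm{op}}+\|\Delta\|_{\mathrm{op}}. \] Then the semidefinite program \[ \max_{X\in\mathbb{R}^{nd\times nd}}\ \langle A,X\rangle\quad\text{s.t.}\quad X_{ii}=I_d\ (1\le i\le n),\ X\succeq 0 \] has a unique global maximizer $\widehat X$, this maximizer has rank exactly $d$, and $\widehat X=\widehat R\widehat R^{\top}$ where $\widehat R^{\top}=[\widehat R_1^{\top},\dots,\widehat R_n^{\top}]$ with $\widehat R_i\in O(d)$ is a global maximizer of \[ \max_{R_1,\dots,R_n\in O(d)}\ \sum_{i=1}^n\sum_{j=1}^n\langle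 R_iR_j^{\top},A_{ij}\rangle ; \] that is, the solutions of the SDP relaxation and of this (least squares) problem coincide.
   Context: $O(d)=\{O\in\mathbb{R}^{d\times d}:O^{\top}O=OO^{\top}=I_d\}$; $\langle X,Y\rangle=\mathrm{Tr}(XY^{\top})$; $\|\cdot\|_{\mathrm{op}}$ is the operator (spectral) norm. The model is orthogonal group synchronization: one observes $A_{ij}=G_iG_j^{\top}+\Delta_{ij}$ with $G_i\in O(d)$; the paper works throughout in the equivalent coordinates obtained by the change of variables $R_i\leftarrow G_i^{\top}R_i$, $\Delta_{ij}\leftarrow G_i^{\top}\Delta_{ij}G_j$, in which $A_{ij}=I_d+\Delta_{ij}$ and the ground truth is $G=Z$ (all blocks $I_d$). *)

theory Defs
  imports "HOL-Analysis.Analysis"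
begin

text \<open>Block matrices: an nd x nd matrix is indexed by pairs (block index, inner index),
  block index type 'n (n = CARD('n)), inner index type 'd (d = CARD('d)).\<close>

definition op_norm :: "real^'m^'k \<Rightarrow> real" where
  "op_norm M = onorm (\<lambda>x. M *v x)"

definition frob_inner :: "real^'m^'k \<Rightarrow> real^'m^'k \<Rightarrow> real" where
  "frob_inner X Y = (\<Sum>i\<in>UNIV. \<Sum>j\<in>UNIV. X $ i $ j * Y $ i $ j)"

definition psd :: "real^'m^'m \<Rightarrow> bool" where
  "psd X \<longleftrightarrow> transpose X = X \<and> (\<forall>v. 0 \<le> v \<bullet> (X *v v))"

definition blk :: "real^('n::finite \<times> 'd::finite)^('n \<times> 'd) \<Rightarrow> 'n \<Rightarrow> 'n \<Rightarrow> real^'d^'d" where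
  "blk M i j = (\<chi> a b. M $ (i, a) $ (j, b))"

definition Zmat :: "real^'d::finite^('n::finite \<times> 'd)" where
  "Zmat = (\<chi> p b. if snd p = b then 1 else 0)"

definition Delta_i :: "real^('n::finite \<times> 'd::finite)^('n \<times> 'd) \<Rightarrow> 'n \<Rightarrow> real^'d^('n \<times> 'd)" where
  "Delta_i D i = (\<chi> q a. D $ (i, a) $ q)"

definition stack :: "('n::finite \<Rightarrow> real^'d::finite^'d) \<Rightarrow> real^'d^('n \<times> 'd)" where
  "stack R = (\<chi> p b. R (fst p) $ snd p $ b)"

definition sdp_feasible :: "real^('n::finite \<times> 'd::finite)^('n \<times> 'd) \<Rightarrow> bool" where
  "sdp_feasible X \<longleftrightarrow> (\<forall>i. blk X i i = mat 1) \<and> psd X"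

definition sdp_maximizer :: "real^('n::finite \<times> 'd::finite)^('n \<times> 'd) \<Rightarrow> real^('n \<times> 'd)^('n \<times> 'd) \<Rightarrow> bool" where
  "sdp_maximizer A X \<longleftrightarrow> sdp_feasible X \<and>
     (\<forall>Y. sdp_feasible Y \<longrightarrow> frob_inner A Y \<le> frob_inner A X)"

definition ls_obj :: "real^('n::finite \<times> 'd::finite)^('n \<times> 'd) \<Rightarrow> ('n \<Rightarrow> real^'d^'d) \<Rightarrow> real" where
  "ls_obj A R = (\<Sum>i\<in>UNIV. \<Sum>j\<in>UNIV. frob_inner (R i ** transpose (R j)) (blk A i j))"

definition ls_maximizer :: "real^('n::finite \<times> 'd::finite)^('n \<times> 'd) \<Rightarrow> ('n \<Rightarrow> real^'d^'d) \<Rightarrow> bool" where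
  "ls_maximizer A R \<longleftrightarrow> (\<forall>i. orthogonal_matrix (R i)) \<and>
     (\<forall>S. (\<forall>i. orthogonal_matrix (S i)) \<longrightarrow> ls_obj A S \<le> ls_obj A R)"

end

theory Submission
  imports Defs
begin

text \<open>
  Let \<open>S\<close> be the stack of a least squares maximizer, rotated so that \<open>M = Z\<^sup>T S\<close> is positive
  semidefinite, and let \<open>e\<close> be the Frobenius norm of \<open>S - Z\<close>. Comparing the objective at \<open>S\<close> and at
  \<open>Z\<close> gives \<open>n e\<^sup>2 / 2 \<le> \<parallel>\<Delta>\<parallel> e \<parallel>S + Z\<parallel>\<close>, and \<open>\<parallel>S + Z\<parallel>\<^sup>2 = 4nd - e\<^sup>2\<close>, so that
  \<open>e < 4 \<surd>(d/n) \<parallel>\<Delta>\<parallel>\<close> unless \<open>e = 0\<close>. This strictness is what makes the non-strict hypothesis enough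
  for uniqueness.

  Optimality in the single block \<open>R\<^sub>i\<close> makes \<open>L\<^sub>i = (A S)\<^sub>i R\<^sub>i\<^sup>T\<close> symmetric positive semidefinite, so
  its least eigenvalue is the least singular value of \<open>(A S)\<^sub>i = M + \<Delta>\<^sub>i\<^sup>T Z + \<Delta>\<^sub>i\<^sup>T (S - Z)\<close>, which is at
  least \<open>n - e\<^sup>2/2 - \<parallel>\<Delta>\<^sub>i\<^sup>T Z\<parallel> - \<parallel>\<Delta>\<^sub>i\<parallel> e\<close>. On the kernel of \<open>S\<^sup>T\<close> the quadratic form of \<open>A\<close> is at most
  \<open>e\<^sup>2 + \<parallel>\<Delta>\<parallel>\<close>. Hence \<open>diag(L\<^sub>i) - A\<close> annihilates \<open>S\<close> and is positive definite on the orthogonal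
  complement of its columns: it is a strictly complementary dual certificate for \<open>S S\<^sup>T\<close>.
\<close>

section \<open>Frobenius inner product, adjoints and the operator norm\<close>

declare transpose_matrix_vector [simp del]

lemma frob_inner_eq_inner: "frob_inner X Y = X \<bullet> Y"
  by (simp add: frob_inner_def inner_vec_def)

lemma inner_matrix_vector_transpose: "x \<bullet> (A *v y) = (transpose A *v x) \<bullet> (y :: real^'m)"
  for A :: "real^'m^'k"
  by (simp add: dot_lmul_matrix transpose_matrix_vector)

lemma inner_matrix_mult_left: "(A ** B) \<bullet> C = B \<bullet> (transpose A ** C)"
  for A :: "real^'m^'k" and B :: "real^'l^'m"
proof -
  have "(A ** B) \<bullet> C = (\<Sum>i\<in>UNIV. \<Sum>j\<in>UNIV. \<Sum>k\<in>UNIV. A$i$k * B$k$j * C$i$j)"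
    by (simp add: inner_vec_def matrix_matrix_mult_def sum_distrib_right)
  also have "\<dots> = (\<Sum>k\<in>UNIV. \<Sum>j\<in>UNIV. \<Sum>i\<in>UNIV. A$i$k * B$k$j * C$i$j)"
  proof -
    have "(\<Sum>j\<in>UNIV. \<Sum>k\<in>UNIV. A$i$k * B$k$j * C$i$j) = (\<Sum>k\<in>UNIV. \<Sum>j\<in>UNIV. A$i$k * B$k$j * C$i$j)" for i
      by (rule sum.swap)
    moreover have "(\<Sum>i\<in>UNIV. \<Sum>j\<in>UNIV. A$i$k * B$k$j * C$i$j) = (\<Sum>j\<in>UNIV. \<Sum>i\<in>UNIV. A$i$k * B$k$j * C$i$j)" for k
      by (rule sum.swap)
    ultimately show ?thesis using sum.swap[of "\<lambda>i k. \<Sum>j\<in>UNIV. A$i$k * B$k$j * C$i$j" UNIV UNIV] by simp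
  qed
  also have "\<dots> = B \<bullet> (transpose A ** C)"
    by (simp add: inner_vec_def matrix_matrix_mult_def sum_distrib_left transpose_def mult_ac)
  finally show ?thesis .
qed

lemma inner_transpose: "transpose A \<bullet> transpose B = A \<bullet> (B :: real^'m^'k)"
  by (simp add: inner_vec_def transpose_def) (rule sum.swap)

lemma inner_matrix_mult_right: "(A ** B) \<bullet> C = A \<bullet> (C ** transpose B)"
  for A :: "real^'m^'k" and B :: "real^'l^'m"
proof -
  have "(A ** B) \<bullet> C = (transpose B ** transpose A) \<bullet> transpose C"
    by (metis inner_transpose matrix_transpose_mul)
  also have "\<dots> = transpose A \<bullet> transpose (C ** transpose B)"
    by (simp add: inner_matrix_mult_left matrix_transpose_mul)
  finally show ?thesis by (simp add: inner_transpose)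
qed

lemma inner_matrix_columns: "A \<bullet> B = (\<Sum>k\<in>UNIV. (A *v axis k 1) \<bullet> (B *v axis k 1))"
  for A B :: "real^'m^'k"
  unfolding matrix_vector_mult_basis by (simp add: inner_vec_def column_def) (rule sum.swap)

lemma norm_matrix_vector_le_op_norm: "norm (A *v x) \<le> op_norm A * norm x"
  for A :: "real^'m^'k"
  unfolding op_norm_def by (rule onorm) (simp add: linear_linear)

lemma op_norm_nonneg: "0 \<le> op_norm A" for A :: "real^'m^'k"
  unfolding op_norm_def by (rule onorm_pos_le) (simp add: linear_linear)

text \<open>Here \<open>norm\<close> of a matrix is the Frobenius norm, whose square is a sum over
  columns; the operator norm bound is applied to each column of \<open>B\<close>.\<close>

lemma norm_matrix_mult_le_op_norm: "norm (A ** B) \<le> op_norm A * norm B"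
  for A :: "real^'m^'k" and B :: "real^'l^'m"
proof (rule power2_le_imp_le)
  have "(norm (A ** B))\<^sup>2 = (\<Sum>k\<in>UNIV. (norm (A *v (B *v axis k 1)))\<^sup>2)"
    unfolding power2_norm_eq_inner inner_matrix_columns by (simp add: matrix_vector_mul_assoc)
  also have "\<dots> \<le> (\<Sum>k\<in>UNIV. (op_norm A * norm (B *v axis k 1))\<^sup>2)"
    by (intro sum_mono power_mono norm_matrix_vector_le_op_norm) simp
  also have "\<dots> = (op_norm A * norm B)\<^sup>2"
    unfolding power_mult_distrib power2_norm_eq_inner inner_matrix_columns[of B]
    by (simp add: sum_distrib_left)
  finally show "(norm (A ** B))\<^sup>2 \<le> (op_norm A * norm B)\<^sup>2" .
qed (simp add: op_norm_nonneg)

text \<open>Cauchy-Schwarz in each row. This is how \<open>norm (S - Z)\<close> later controls the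
  error on a single vector.\<close>

lemma norm_matrix_vector_le_norm: "norm (A *v x) \<le> norm A * norm x"
  for A :: "real^'m^'k"
proof (rule power2_le_imp_le)
  have "(norm (A *v x))\<^sup>2 = (\<Sum>i\<in>UNIV. (A$i \<bullet> x)\<^sup>2)"
    unfolding power2_norm_eq_inner by (simp add: inner_vec_def matrix_vector_mult_def power2_eq_square)
  also have "\<dots> \<le> (\<Sum>i\<in>UNIV. (A$i \<bullet> A$i) * (x \<bullet> x))"
    by (intro sum_mono Cauchy_Schwarz_ineq)
  also have "\<dots> = (norm A * norm x)\<^sup>2"
    unfolding power_mult_distrib power2_norm_eq_inner inner_vec_def[of A]
    by (simp add: sum_distrib_right)
  finally show "(norm (A *v x))\<^sup>2 \<le> (norm A * norm x)\<^sup>2" .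
qed simp

lemma norm_transpose: "norm (transpose A) = norm (A :: real^'m^'k)"
  by (simp add: norm_eq_sqrt_inner inner_transpose)

text \<open>Pairing \<open>transpose A *v x\<close> with itself and moving \<open>A\<close> to the
  other side reduces to the bound for \<open>A\<close>; one factor \<open>norm ?y\<close> then
  cancels.\<close>

lemma norm_transpose_vector_le_op_norm: "norm (transpose A *v x) \<le> op_norm A * norm x"
  for A :: "real^'m^'k"
proof -
  let ?y = "transpose A *v x"
  have "norm ?y * norm ?y = x \<bullet> (A *v ?y)"
    by (simp add: inner_matrix_vector_transpose power2_norm_eq_inner flip: power2_eq_square)
  also have "\<dots> \<le> norm x * (op_norm A * norm ?y)"
    by (meson mult_left_mono norm_cauchy_schwarz norm_ge_zero norm_matrix_vector_le_op_norm order_trans)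
  finally have "norm ?y * norm ?y \<le> (op_norm A * norm x) * norm ?y" by (simp add: mult_ac)
  then show ?thesis
    by (cases "?y = 0") (simp_all add: op_norm_nonneg)
qed

subsection \<open>Positive semidefinite matrices\<close>

text \<open>The form at \<open>s x + t y\<close> is a nonnegative binary quadratic form. The choices
  \<open>(-q, p)\<close> and \<open>(r, -q)\<close> expose \<open>p * r - q^2\<close> times
  \<open>p\<close> or \<open>r\<close>; if both vanish, \<open>(1, 1)\<close> and
  \<open>(1, -1)\<close> force \<open>q = 0\<close>.\<close>

lemma psd_Cauchy_Schwarz:
  fixes N :: "real^'m^'m"
  assumes "psd N"
  shows "(x \<bullet> (N *v y))\<^sup>2 \<le> (x \<bullet> (N *v x)) * (y \<bullet> (N *v y))"
proof -
  define p q r where "p = x \<bullet> (N *v x)" and "q = x \<bullet> (N *v y)" and "r = y \<bullet> (N *v y)"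
  have sym: "y \<bullet> (N *v x) = q"
    using assms unfolding q_def psd_def by (metis inner_commute inner_matrix_vector_transpose)
  have nonneg: "0 \<le> s\<^sup>2 * p + 2 * s * t * q + t\<^sup>2 * r" for s t
  proof -
    have "(s *\<^sub>R x + t *\<^sub>R y) \<bullet> (N *v (s *\<^sub>R x + t *\<^sub>R y)) = s\<^sup>2 * p + 2 * s * t * q + t\<^sup>2 * r"
      unfolding matrix_vector_right_distrib matrix_vector_mult_scaleR inner_add_left inner_add_right
        inner_scaleR_left inner_scaleR_right sym p_def[symmetric] q_def[symmetric] r_def[symmetric]
      by (simp add: power2_eq_square algebra_simps)
    then show ?thesis using assms unfolding psd_def by metis
  qed
  have "p \<ge> 0" "r \<ge> 0" using assms unfolding psd_def p_def r_def by auto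
  then consider "p > 0" | "r > 0" | "p = 0" "r = 0" by linarith
  then have "q\<^sup>2 \<le> p * r"
  proof cases
    case 1
    have "0 \<le> p * (p * r - q\<^sup>2)"
      using nonneg[of "- q" p] by (simp add: power2_eq_square algebra_simps)
    then show ?thesis using 1 by (simp add: zero_le_mult_iff)
  next
    case 2
    have "0 \<le> r * (p * r - q\<^sup>2)"
      using nonneg[of r "- q"] by (simp add: power2_eq_square algebra_simps)
    then show ?thesis using 2 by (simp add: zero_le_mult_iff)
  next
    case 3
    then show ?thesis using nonneg[of 1 1] nonneg[of 1 "-1"] by simp
  qed
  then show ?thesis unfolding p_def q_def r_def .
qed

lemma psd_kernel:
  fixes N :: "real^'m^'m"
  assumes "psd N" "x \<bullet> (N *v x) = 0"
  shows "N *v x = 0"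
proof -
  have "((N *v x) \<bullet> (N *v x))\<^sup>2 \<le> 0"
    using psd_Cauchy_Schwarz[OF assms(1), of "N *v x" x] assms(2) by simp
  then show ?thesis by simp
qed

text \<open>This passes from singular values to eigenvalues without diagonalizing:
  \<open>bound\<close> makes \<open>N\<close> invertible, and Cauchy-Schwarz for the form of
  \<open>N\<close> is applied to \<open>x\<close> and its preimage \<open>y\<close>, where
  \<open>x \<bullet> (N *v y) = x \<bullet> x\<close>.\<close>

lemma psd_lower_bound:
  fixes N :: "real^'m^'m"
  assumes "psd N" "c > 0" and bound: "\<And>y. c * norm y \<le> norm (N *v y)"
  shows "c * (x \<bullet> x) \<le> x \<bullet> (N *v x)"
proof (cases "x = 0")
  case False
  have "inj ((*v) N)"
    using bound \<open>c > 0\<close> by (intro linear_injective_0[THEN iffD2]) (auto, metis mult_le_0_iff norm_le_zero_iff norm_zero not_less)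
  then have "surj ((*v) N)" by (simp add: linear_injective_imp_surjective)
  then obtain y where y: "N *v y = x" by (metis surj_def)
  have xy: "c * (y \<bullet> x) \<le> x \<bullet> x"
  proof -
    have "c * (y \<bullet> x) \<le> (c * norm y) * norm x"
      using norm_cauchy_schwarz[of y x] \<open>c > 0\<close> by (simp add: mult.assoc)
    also have "\<dots> \<le> norm x * norm x" using bound[of y] y by (intro mult_right_mono) auto
    finally show ?thesis by (simp add: power2_norm_eq_inner flip: power2_eq_square)
  qed
  have "(x \<bullet> x)\<^sup>2 \<le> (x \<bullet> (N *v x)) * (y \<bullet> x)"
    using psd_Cauchy_Schwarz[OF assms(1), of x y] y by simp
  then have "c * (x \<bullet> x)\<^sup>2 \<le> (x \<bullet> (N *v x)) * (c * (y \<bullet> x))"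
    using \<open>c > 0\<close> by (simp add: mult.left_commute)
  also have "\<dots> \<le> (x \<bullet> (N *v x)) * (x \<bullet> x)"
    using xy assms(1) by (intro mult_left_mono) (auto simp: psd_def)
  finally show ?thesis using False by (simp add: power2_eq_square flip: mult.assoc)
qed simp

text \<open>\<open>mat 1 \<bullet> M\<close> is the trace. As forms,
  \<open>0 \<le> M \<le> c I\<close> gives \<open>M^2 \<le> c M\<close>, by Cauchy-Schwarz between
  \<open>M *v x\<close> and \<open>x\<close>; summing over the basis takes traces.\<close>

lemma norm_square_psd_le:
  fixes M :: "real^'m^'m"
  assumes "psd M" and ub: "\<And>x. x \<bullet> (M *v x) \<le> c * (x \<bullet> x)"
  shows "(norm M)\<^sup>2 \<le> c * (mat 1 \<bullet> M)"
proof -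
  have col: "(norm (M *v x))\<^sup>2 \<le> c * (x \<bullet> (M *v x))" for x
  proof (cases "M *v x = 0")
    case False
    let ?y = "M *v x"
    have "(?y \<bullet> ?y)\<^sup>2 \<le> (?y \<bullet> (M *v ?y)) * (x \<bullet> ?y)"
      using psd_Cauchy_Schwarz[OF assms(1), of ?y x] by simp
    also have "\<dots> \<le> (c * (?y \<bullet> ?y)) * (x \<bullet> ?y)"
      using ub assms(1) by (intro mult_right_mono) (auto simp: psd_def)
    finally have "(?y \<bullet> ?y) * (?y \<bullet> ?y) \<le> (?y \<bullet> ?y) * (c * (x \<bullet> ?y))"
      by (simp add: power2_eq_square mult_ac)
    then show ?thesis using False unfolding power2_norm_eq_inner by simp
  qed simp
  have "(norm M)\<^sup>2 = (\<Sum>k\<in>UNIV. (norm (M *v axis k 1))\<^sup>2)"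
    unfolding power2_norm_eq_inner by (rule inner_matrix_columns)
  also have "\<dots> \<le> (\<Sum>k\<in>UNIV. c * (axis k 1 \<bullet> (M *v axis k 1)))"
    by (intro sum_mono col)
  also have "\<dots> = c * (mat 1 \<bullet> M)" by (simp add: inner_matrix_columns sum_distrib_left)
  finally show ?thesis .
qed

lemma psd_diagonal_nonneg: "psd X \<Longrightarrow> 0 \<le> X $ k $ k"
  unfolding psd_def
  by (metis cart_eq_inner_axis column_def inner_commute matrix_vector_mult_basis vec_lambda_beta)

lemma psd_diagonal_zero:
  assumes "psd X" "X $ k $ k = 0"
  shows "X *v axis k 1 = 0"
  using assms by (intro psd_kernel) (auto simp: matrix_vector_mult_basis column_def inner_axis')

text \<open>One step of Cholesky elimination at a positive pivot lowers the number of nonzero rows.\<close>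

lemma psd_inner_nonneg:
  fixes T X :: "real^'m^'m"
  assumes T: "psd T" and "psd X"
  shows "0 \<le> T \<bullet> X"
  using assms(2)
proof (induction "card {k. X $ k \<noteq> 0}" arbitrary: X rule: less_induct)
  case less
  have rows: "X $ k = X *v axis k 1" for k
    using less.prems by (metis psd_def matrix_vector_mult_basis row_def column_transpose vec_lambda_eta)
  show ?case
  proof (cases "X = 0")
    case False
    then obtain k where k: "X $ k \<noteq> 0" by (auto simp: vec_eq_iff)
    define w p where "w = X $ k" and "p = X $ k $ k"
    \<comment> \<open>A zero diagonal entry would make the whole row vanish, so any nonzero row
      supplies a positive pivot.\<close>
    have "p \<noteq> 0" using psd_diagonal_zero[OF less.prems, of k] rows[of k] k unfolding p_def by auto
    then have p: "p > 0" using psd_diagonal_nonneg[OF less.prems, of k] unfolding p_def by simp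
    have w: "w = X *v axis k 1" unfolding w_def by (rule rows)
    \<comment> \<open>\<open>W\<close> is the rank one matrix \<open>w w^T / p\<close>. The Schur
      complement \<open>X - W\<close> has row \<open>k\<close> cleared and stays psd by
      Cauchy-Schwarz between \<open>axis k 1\<close> and \<open>v\<close>.\<close>
    define W :: "real^'m^'m" where "W = (\<chi> i j. w $ i * w $ j / p)"
    have Wv: "W *v v = ((w \<bullet> v) / p) *\<^sub>R w" for v
      by (simp add: vec_eq_iff W_def matrix_vector_mult_def inner_vec_def sum_distrib_left
          sum_distrib_right sum_divide_distrib mult_ac)
    have TW: "T \<bullet> W = (w \<bullet> (T *v w)) / p"
      by (simp add: W_def matrix_vector_mult_def inner_vec_def sum_distrib_left
          sum_distrib_right sum_divide_distrib mult_ac)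
    have symX: "transpose X = X" using less.prems unfolding psd_def by simp
    have symW: "transpose W = W" by (simp add: W_def transpose_def mult_ac)
    have wv: "w \<bullet> v = axis k 1 \<bullet> (X *v v)" for v
      unfolding w inner_matrix_vector_transpose symX ..
    have "psd (X - W)"
      unfolding psd_def
    proof (intro conjI allI)
      show "transpose (X - W) = X - W"
        using symX symW by (simp add: transpose_def vec_eq_iff)
      fix v
      have "(w \<bullet> v)\<^sup>2 \<le> p * (v \<bullet> (X *v v))"
        using psd_Cauchy_Schwarz[OF less.prems, of "axis k 1" v]
        unfolding wv[symmetric] by (simp add: w_def inner_axis p_def)
      then show "0 \<le> v \<bullet> ((X - W) *v v)"
        using p by (simp add: matrix_vector_mult_diff_rdistrib inner_diff_right Wv inner_commute[of v w]
            field_simps power2_eq_square)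
    qed
    moreover have "card {i. (X - W) $ i \<noteq> 0} < card {i. X $ i \<noteq> 0}"
    proof (rule psubset_card_mono)
      \<comment> \<open>By symmetry a zero row is also a zero column, so \<open>w\<close> vanishes
        there and the elimination creates no new nonzero row.\<close>
      have "(X - W) $ i = 0" if "X $ i = 0" for i
      proof -
        have "w $ i = 0" using that arg_cong[OF symX, of "\<lambda>N. N $ i $ k"]
          by (simp add: w_def transpose_def)
        then show ?thesis using that by (simp add: W_def vec_eq_iff)
      qed
      moreover have "(X - W) $ k = 0"
        using p by (simp add: vec_eq_iff W_def w_def p_def)
      ultimately show "{i. (X - W) $ i \<noteq> 0} \<subset> {i. X $ i \<noteq> 0}" using k by blast
    qed simp
    ultimately have "0 \<le> T \<bullet> (X - W)" by (rule less.hyps[rotated])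
    moreover have "0 \<le> T \<bullet> W" using T p unfolding TW psd_def by simp
    ultimately show ?thesis by (simp add: inner_diff_right)
  qed simp
qed

subsection \<open>Orthogonal matrices\<close>

text \<open>The Householder reflection in the hyperplane orthogonal to \<open>a\<close>. For
  \<open>a = 0\<close> division by zero yields the identity, so orthogonality holds for every
  \<open>a\<close>.\<close>

definition reflection_matrix :: "real^'d \<Rightarrow> real^'d^'d" where
  "reflection_matrix a = (\<chi> i j. (if i = j then 1 else 0) - 2 / (a \<bullet> a) * (a $ i * a $ j))"

lemma reflection_matrix_vector:
  "reflection_matrix a *v x = x - (2 * (a \<bullet> x) / (a \<bullet> a)) *\<^sub>R a"
proof -
  have "(reflection_matrix a *v x) $ i = (x - (2 * (a \<bullet> x) / (a \<bullet> a)) *\<^sub>R a) $ i" for i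
  proof -
    have "(\<Sum>j\<in>UNIV. ((if i = j then 1 else 0) - 2 / (a \<bullet> a) * (a $ i * a $ j)) * x $ j)
        = (\<Sum>j\<in>UNIV. (if i = j then 1 else 0) * x $ j) - 2 / (a \<bullet> a) * a $ i * (\<Sum>j\<in>UNIV. a $ j * x $ j)"
      unfolding left_diff_distrib sum_subtractf sum_distrib_left by (simp add: mult_ac)
    also have "(\<Sum>j\<in>UNIV. (if i = j then 1 else 0) * x $ j) = x $ i"
      by (simp add: if_distrib[of "\<lambda>t. t * _"] cong: if_cong)
    finally show ?thesis
      by (simp add: reflection_matrix_def matrix_vector_mult_def inner_vec_def[of a x])
  qed
  then show ?thesis by (simp add: vec_eq_iff)
qed

lemma transpose_reflection_matrix: "transpose (reflection_matrix a) = reflection_matrix a"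
  by (simp add: reflection_matrix_def transpose_def vec_eq_iff mult_ac)

lemma orthogonal_reflection_matrix: "orthogonal_matrix (reflection_matrix a)"
proof -
  have "reflection_matrix a *v (reflection_matrix a *v x) = x" for x
    by (simp add: reflection_matrix_vector inner_diff_right)
  then have "reflection_matrix a ** reflection_matrix a = mat 1"
    by (simp add: matrix_eq matrix_vector_mul_assoc)
  then show ?thesis by (simp add: orthogonal_matrix_def transpose_reflection_matrix)
qed

lemma reflection_matrix_inner:
  "reflection_matrix a \<bullet> M = mat 1 \<bullet> M - 2 / (a \<bullet> a) * (a \<bullet> (M *v a))"
proof -
  have "reflection_matrix a = mat 1 - (2 / (a \<bullet> a)) *\<^sub>R (\<chi> i j. a $ i * a $ j)"
    by (simp add: reflection_matrix_def mat_def vec_eq_iff)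
  moreover have "(\<chi> i j. a $ i * a $ j) \<bullet> M = a \<bullet> (M *v a)"
    by (simp add: matrix_vector_mult_def inner_vec_def sum_distrib_left mult_ac)
  ultimately show ?thesis by (simp add: inner_diff_left)
qed

text \<open>Single reflections give positivity; products of two reflections (plane rotations) give symmetry.\<close>

lemma psd_if_identity_maximizes_inner:
  fixes M :: "real^'d^'d"
  assumes max: "\<And>Q. orthogonal_matrix Q \<Longrightarrow> Q \<bullet> M \<le> mat 1 \<bullet> M"
  shows "psd M"
proof -
  have nonneg: "0 \<le> v \<bullet> (M *v v)" for v
  proof (cases "v = 0")
    case False
    then show ?thesis
      using max[OF orthogonal_reflection_matrix, of v]
      by (simp add: reflection_matrix_inner zero_le_divide_iff)
        (metis inner_gt_zero_iff not_less)
  qed simp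
  have "M $ i $ j = M $ j $ i" if "i \<noteq> j" for i j
  proof -
    define a c :: "real^'d" where "a = axis i 1" and "c = axis j 1"
    define p q r s where "p = a \<bullet> (M *v a)" and "q = a \<bullet> (M *v c)"
      and "r = c \<bullet> (M *v a)" and "s = c \<bullet> (M *v c)"
    have ac: "a \<bullet> a = 1" "c \<bullet> c = 1" "a \<bullet> c = 0" "c \<bullet> a = 0"
      using that by (auto simp: a_def c_def inner_axis_axis)
    \<comment> \<open>Reflecting in \<open>b = a + t c\<close> and then in \<open>a\<close> rotates
      the plane of \<open>a\<close> and \<open>c\<close> by an angle of first order in
      \<open>t\<close>. The antisymmetric part \<open>q - r\<close> therefore enters linearly and
      the diagonal part quadratically, so a small \<open>t\<close> of the right sign excludes
      \<open>q \<noteq> r\<close>.\<close>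
    have le: "t * (q - r) \<le> t\<^sup>2 * (p + s)" for t
    proof -
      define b where "b = a + t *\<^sub>R c"
      have b: "a \<bullet> b = 1" "b \<bullet> b = 1 + t\<^sup>2"
        by (simp_all add: b_def inner_add_left inner_add_right ac power2_eq_square)
      have pos: "1 + t\<^sup>2 > 0" by (simp add: add_pos_nonneg)
      have bM: "b \<bullet> (M *v b) = p + t * q + t * r + t\<^sup>2 * s" "a \<bullet> (M *v b) = p + t * q"
        by (simp_all add: b_def inner_add_left inner_add_right matrix_vector_right_distrib
            matrix_vector_mult_scaleR p_def q_def r_def s_def power2_eq_square distrib_left)
      have "(reflection_matrix a ** reflection_matrix b) \<bullet> M
          = reflection_matrix b \<bullet> (reflection_matrix a ** M)"
        by (simp add: inner_matrix_mult_left transpose_reflection_matrix)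
      also have "\<dots> = mat 1 \<bullet> (reflection_matrix a ** M)
          - 2 / (b \<bullet> b) * (b \<bullet> (reflection_matrix a *v (M *v b)))"
        by (simp add: reflection_matrix_inner matrix_vector_mul_assoc)
      also have "mat 1 \<bullet> (reflection_matrix a ** M) = reflection_matrix a \<bullet> M"
        using inner_matrix_mult_left[of "reflection_matrix a" "mat 1" M]
        by (simp add: transpose_reflection_matrix)
      also have "\<dots> = mat 1 \<bullet> M - 2 * p"
        by (simp add: reflection_matrix_inner ac p_def)
      also have "b \<bullet> (reflection_matrix a *v (M *v b)) = (p + t * q + t * r + t\<^sup>2 * s) - 2 * (p + t * q)"
        by (simp add: reflection_matrix_vector inner_diff_right ac bM b inner_commute[of b a])
      finally have "- 2 * p - 2 / (1 + t\<^sup>2) * ((p + t * q + t * r + t\<^sup>2 * s) - 2 * (p + t * q)) \<le> 0"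
        using max[OF orthogonal_matrix_mul[OF orthogonal_reflection_matrix orthogonal_reflection_matrix], of a b]
        by (simp add: b)
      then show ?thesis using pos by (simp add: field_simps)
    qed
    \<comment> \<open>The test value is \<open>t = (q - r) / K\<close>. The extra \<open>1\<close>
      keeps \<open>K\<close> positive when \<open>p + s = 0\<close> and leaves the surplus
      \<open>(q - r)^2 / K^2\<close>, which must vanish.\<close>
    define K where "K = p + s + 1"
    have "p \<ge> 0" "s \<ge> 0" unfolding p_def s_def by (rule nonneg)+
    then have K: "K > 0" unfolding K_def by simp
    have "(q - r)\<^sup>2 / K \<le> (q - r)\<^sup>2 / K\<^sup>2 * (K - 1)"
      using le[of "(q - r) / K"] by (simp add: K_def power2_eq_square)
    also have "(q - r)\<^sup>2 / K\<^sup>2 * (K - 1) = (q - r)\<^sup>2 / K - (q - r)\<^sup>2 / K\<^sup>2"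
      using K by (simp add: right_diff_distrib power2_eq_square[of K])
    finally have "q = r" using K by (simp add: divide_le_0_iff)
    then show ?thesis
      by (simp add: q_def r_def a_def c_def matrix_vector_mult_basis column_def inner_axis')
  qed
  then have "transpose M = M" by (simp add: transpose_def vec_eq_iff) metis
  with nonneg show ?thesis by (simp add: psd_def)
qed

section \<open>Compactness of the orthogonal group and polar alignment\<close>

lemma compact_orthogonal_matrices: "compact {Q :: real^'d^'d. orthogonal_matrix Q}"
proof -
  have eq: "{Q :: real^'d^'d. orthogonal_matrix Q}
      = {Q. \<forall>i j. (\<Sum>k\<in>UNIV. Q $ k $ i * Q $ k $ j) = (if i = j then 1 else 0)}"
    by (auto simp: orthogonal_matrix matrix_matrix_mult_def transpose_def mat_def vec_eq_iff)
  have "closed {Q :: real^'d^'d. orthogonal_matrix Q}"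
    unfolding eq by (intro closed_Collect_all closed_Collect_eq continuous_intros)
  moreover have "norm Q = sqrt (real CARD('d))" if "orthogonal_matrix Q" for Q :: "real^'d^'d"
  proof -
    have "(\<Sum>k\<in>UNIV. Q $ k $ i * Q $ k $ i) = 1" for i
      using that unfolding eq[unfolded set_eq_iff mem_Collect_eq, rule_format] by simp
    then have "Q \<bullet> Q = CARD('d)"
      by (simp add: inner_vec_def) (subst sum.swap, simp)
    then show ?thesis by (simp add: norm_eq_sqrt_inner)
  qed
  then have "bounded {Q :: real^'d^'d. orthogonal_matrix Q}"
    by (auto simp: bounded_iff)
  ultimately show ?thesis by (simp add: compact_eq_bounded_closed)
qed

text \<open>A variational polar decomposition: if \<open>Q\<close> maximizes
  \<open>Q \<bullet> M\<close> over the compact orthogonal group, comparison with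
  \<open>P ** Q\<close> shows that the identity is optimal for
  \<open>M ** transpose Q\<close>.\<close>

lemma exists_orthogonal_psd_mult:
  fixes M :: "real^'d^'d"
  obtains Q where "orthogonal_matrix Q" "psd (M ** Q)"
proof -
  have "\<exists>Q\<in>{Q. orthogonal_matrix Q}. \<forall>P\<in>{Q. orthogonal_matrix Q}. P \<bullet> M \<le> Q \<bullet> M"
    by (intro continuous_attains_sup compact_orthogonal_matrices continuous_intros)
       (use orthogonal_matrix_id in blast)
  then obtain Q where Q: "orthogonal_matrix Q"
    and max: "\<And>P. orthogonal_matrix P \<Longrightarrow> P \<bullet> M \<le> Q \<bullet> M" by auto
  have "psd (M ** transpose Q)"
  proof (rule psd_if_identity_maximizes_inner)
    fix P :: "real^'d^'d" assume "orthogonal_matrix P"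
    then have "(P ** Q) \<bullet> M \<le> Q \<bullet> M" using Q by (intro max orthogonal_matrix_mul)
    then show "P \<bullet> (M ** transpose Q) \<le> mat 1 \<bullet> (M ** transpose Q)"
      using inner_matrix_mult_right[of P Q M] inner_matrix_mult_right[of "mat 1" Q M] by simp
  qed
  then show ?thesis using that Q by (metis orthogonal_matrix_transpose)
qed

subsection \<open>Block matrices\<close>

text \<open>The entry type is arbitrary so that one notion cuts both vectors (real entries) and tall
  matrices (rows as entries).\<close>

definition block :: "'a^('n::finite \<times> 'd::finite) \<Rightarrow> 'n \<Rightarrow> 'a^'d" where
  "block u i = (\<chi> a. u $ (i, a))"

definition block_diag :: "('n::finite \<Rightarrow> real^'d::finite^'d) \<Rightarrow> real^('n \<times> 'd)^('n \<times> 'd)" where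
  "block_diag L = (\<chi> p q. if fst p = fst q then L (fst p) $ snd p $ snd q else 0)"

lemma sum_block_index:
  "(\<Sum>p\<in>UNIV. f p) = (\<Sum>i\<in>UNIV. \<Sum>a\<in>UNIV. f (i, a))"
  for f :: "'n::finite \<times> 'd::finite \<Rightarrow> 'b::comm_monoid_add"
  by (simp add: sum.cartesian_product flip: UNIV_Times_UNIV)

lemma block_eqI: "(\<And>i. block u i = block v i) \<Longrightarrow> u = v"
  by (simp add: block_def vec_eq_iff)

lemma block_add: "block (u + v) i = block u i + block v i"
  and block_diff: "block (u - v) i = block u i - block v i"
  by (simp_all add: block_def vec_eq_iff)

lemma block_stack [simp]: "block (stack R) i = R i"
  by (simp add: block_def stack_def vec_eq_iff)

lemma block_Zmat [simp]: "block Zmat i = mat 1"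
  by (simp add: block_def Zmat_def mat_def vec_eq_iff)

lemma Zmat_eq_stack: "Zmat = stack (\<lambda>_. mat 1)"
  by (rule block_eqI) simp

lemma inner_block: "u \<bullet> v = (\<Sum>i\<in>UNIV. block u i \<bullet> block v i)"
  for u :: "'a::real_inner^('n::finite \<times> 'd::finite)"
  by (simp add: inner_vec_def block_def sum_block_index)

lemma block_matrix_mult: "block (S ** B) i = block S i ** B"
  by (simp add: block_def matrix_matrix_mult_def vec_eq_iff)

lemma block_blk_mult: "block (M ** S) i = (\<Sum>j\<in>UNIV. blk M i j ** block S j)"
  for S :: "real^'k^('n::finite \<times> 'd::finite)"
  by (simp add: block_def blk_def matrix_matrix_mult_def vec_eq_iff sum_block_index sum_component)

lemma transpose_mult_block:
  "transpose S ** T = (\<Sum>i\<in>UNIV. transpose (block S i) ** block T i)"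
  for S T :: "real^'k^('n::finite \<times> 'd::finite)"
  by (simp add: block_def transpose_def matrix_matrix_mult_def vec_eq_iff sum_block_index sum_component)

lemma blk_mult_transpose: "blk (S ** transpose T) i j = block S i ** transpose (block T j)"
  by (simp add: block_def blk_def transpose_def matrix_matrix_mult_def vec_eq_iff)

lemma block_block_diag_mult: "block (block_diag L ** S) i = L i ** block S i"
  for S :: "real^'k^('n::finite \<times> 'd::finite)"
proof -
  have "blk (block_diag L) i j = (if i = j then L i else 0)" for j
    by (simp add: blk_def block_diag_def vec_eq_iff)
  moreover have "(if b then L i else 0) ** block S j = (if b then L i ** block S j else 0)" for b j
    by (simp add: matrix_matrix_mult_def vec_eq_iff)
  ultimately show ?thesis by (simp add: block_blk_mult)
qed

lemma block_diag_component:
  "block_diag L $ (i, a) $ (j, b) = (if i = j then L i $ a $ b else 0)"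
  by (simp add: block_diag_def)

lemma sum_block_if:
  "(\<Sum>j\<in>UNIV. \<Sum>b\<in>UNIV. (if i = j then f b else 0) * g j b) = (\<Sum>b\<in>UNIV. f b * g i b)"
  for f :: "'d::finite \<Rightarrow> real" and i :: "'n::finite"
proof -
  have "(\<Sum>b\<in>UNIV. (if i = j then f b else 0) * g j b) = (if i = j then \<Sum>b\<in>UNIV. f b * g i b else 0)" for j
    by simp
  then show ?thesis by simp
qed

lemma block_block_diag_vector: "block (block_diag L *v u) i = L i *v block u i"
  by (simp add: block_def matrix_vector_mult_def vec_eq_iff sum_block_index block_diag_component
      sum_block_if)

lemma transpose_block_diag:
  "(\<And>i. transpose (L i) = L i) \<Longrightarrow> transpose (block_diag L) = block_diag L"
  by (simp add: block_diag_def transpose_def vec_eq_iff)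

lemma block_diag_inner: "block_diag L \<bullet> X = (\<Sum>i\<in>UNIV. L i \<bullet> blk X i i)"
  by (simp add: inner_vec_def sum_block_index block_diag_component sum_block_if blk_def)

section \<open>Stacks of orthogonal blocks and the least squares objective\<close>

lemma transpose_stack_mult_stack:
  fixes R :: "'n::finite \<Rightarrow> real^'d::finite^'d"
  assumes "\<And>i. orthogonal_matrix (R i)"
  shows "transpose (stack R) ** stack R = real CARD('n) *\<^sub>R mat 1"
  using assms by (simp add: transpose_mult_block orthogonal_matrix sum_constant_scaleR del: sum_constant)

lemma inner_stack_vector:
  fixes R :: "'n::finite \<Rightarrow> real^'d::finite^'d"
  assumes "\<And>i. orthogonal_matrix (R i)"
  shows "(stack R *v x) \<bullet> (stack R *v y) = real CARD('n) * (x \<bullet> y)"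
  by (simp add: inner_matrix_vector_transpose matrix_vector_mul_assoc assms inner_commute
      transpose_stack_mult_stack flip: scaleR_matrix_vector_assoc)

lemma norm_stack:
  fixes R :: "'n::finite \<Rightarrow> real^'d::finite^'d"
  assumes "\<And>i. orthogonal_matrix (R i)"
  shows "(norm (stack R))\<^sup>2 = real CARD('n) * real CARD('d)"
  unfolding power2_norm_eq_inner inner_matrix_columns
  by (simp add: inner_stack_vector assms inner_axis_axis)

lemma psd_gram: "psd (S ** transpose S)" for S :: "real^'k^'m"
proof -
  have "v \<bullet> ((S ** transpose S) *v v) = (transpose S *v v) \<bullet> (transpose S *v v)" for v
    by (metis inner_matrix_vector_transpose matrix_vector_mul_assoc)
  then show ?thesis by (simp add: psd_def matrix_transpose_mul)
qed

lemma sdp_feasible_stack: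
  assumes "\<And>i. orthogonal_matrix (R i)"
  shows "sdp_feasible (stack R ** transpose (stack R))"
  using assms by (simp add: sdp_feasible_def psd_gram blk_mult_transpose orthogonal_matrix_def)

lemma ls_obj_eq_inner: "ls_obj A R = stack R \<bullet> (A ** stack R)"
  by (simp add: ls_obj_def frob_inner_eq_inner inner_block[of "stack R"] block_blk_mult inner_sum_right
      inner_matrix_mult_right)

text \<open>This is the sense in which the SDP relaxes least squares. It also shows that the least
  squares objective depends only on the Gram matrix.\<close>

lemma frob_inner_stack: "frob_inner A (stack R ** transpose (stack R)) = ls_obj A R"
  by (simp add: frob_inner_eq_inner ls_obj_eq_inner inner_commute[of A] inner_matrix_mult_right)

text \<open>Since \<open>S^T S = n I\<close>, the stack \<open>S\<close> is injective and
  \<open>S^T\<close> is surjective with right inverse \<open>S / n\<close>; hence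
  \<open>S S^T\<close> has the same range as \<open>S\<close>.\<close>

lemma rank_stack_gram:
  fixes R :: "'n::finite \<Rightarrow> real^'d::finite^'d"
  assumes "\<And>i. orthogonal_matrix (R i)"
  shows "rank (stack R ** transpose (stack R)) = CARD('d)"
proof -
  let ?S = "stack R"
  have inj: "inj ((*v) ?S)"
  proof (rule injI)
    fix x y assume "?S *v x = ?S *v y"
    then have "transpose ?S *v (?S *v x) = transpose ?S *v (?S *v y)" by simp
    then show "x = y"
      by (simp add: matrix_vector_mul_assoc transpose_stack_mult_stack assms
          flip: scaleR_matrix_vector_assoc)
  qed
  have surj: "\<exists>v. x = transpose ?S *v v" for x
    by (rule exI[of _ "?S *v ((1 / real CARD('n)) *\<^sub>R x)"])
      (simp add: matrix_vector_mul_assoc transpose_stack_mult_stack assms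
          flip: scaleR_matrix_vector_assoc)
  have "range ((*v) (?S ** transpose ?S)) = range ((*v) ?S)"
    using surj by (auto simp: image_iff simp flip: matrix_vector_mul_assoc) metis
  then have "rank (?S ** transpose ?S) = dim (range ((*v) ?S))"
    by (simp add: rank_dim_range)
  also have "\<dots> = CARD('d)" using inj by (simp add: dim_image_eq)
  finally show ?thesis .
qed

text \<open>Families of blocks are encoded as vectors in \<open>real^'d^'d^'n\<close>, where the
  product of orthogonal groups is closed and bounded, so the continuous objective attains its
  maximum.\<close>

lemma exists_ls_maximizer:
  fixes A :: "real^('n::finite \<times> 'd::finite)^('n \<times> 'd)"
  obtains R where "ls_maximizer A R"
proof -
  let ?F = "{V :: real^'d^'d^'n. \<forall>i. V $ i \<in> {Q. orthogonal_matrix Q}}"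
  have cl: "closed {Q :: real^'d^'d. orthogonal_matrix Q}"
    and bd: "bounded {Q :: real^'d^'d. orthogonal_matrix Q}"
    using compact_orthogonal_matrices compact_eq_bounded_closed by blast+
  have "closed {V :: real^'d^'d^'n. V $ i \<in> {Q. orthogonal_matrix Q}}" for i
    using continuous_closed_vimage[OF cl, of "\<lambda>V. V $ i"]
    by (auto simp: vimage_def intro!: continuous_intros)
  then have "closed ?F" by (rule closed_Collect_all)
  moreover obtain B where B: "\<And>Q :: real^'d^'d. orthogonal_matrix Q \<Longrightarrow> norm Q \<le> B"
    using bd by (auto simp: bounded_iff)
  have "norm V \<le> real CARD('n) * B" if "V \<in> ?F" for V
  proof -
    have "norm V \<le> (\<Sum>i\<in>UNIV. norm (V $ i))"
      unfolding norm_vec_def[of V] by (rule L2_set_le_sum) simp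
    also have "\<dots> \<le> (\<Sum>i\<in>(UNIV :: 'n set). B)" using that B by (intro sum_mono) auto
    finally show ?thesis by simp
  qed
  then have "bounded ?F" by (auto simp: bounded_iff)
  ultimately have "compact ?F" by (simp add: compact_eq_bounded_closed)
  moreover have "(\<chi> i. mat 1) \<in> ?F" by (simp add: orthogonal_matrix_id)
  moreover have "continuous_on ?F (\<lambda>V. ls_obj A (\<lambda>i. V $ i))"
    unfolding ls_obj_def frob_inner_def matrix_matrix_mult_def transpose_def
    by (simp, intro continuous_intros)
  ultimately obtain V where V: "V \<in> ?F" "\<And>W. W \<in> ?F \<Longrightarrow> ls_obj A (\<lambda>i. W $ i) \<le> ls_obj A (\<lambda>i. V $ i)"
    using continuous_attains_sup[of ?F "\<lambda>V. ls_obj A (\<lambda>i. V $ i)"] by blast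
  have "ls_maximizer A (\<lambda>i. V $ i)"
    unfolding ls_maximizer_def
  proof (intro conjI allI impI)
    fix S :: "'n \<Rightarrow> real^'d^'d" assume "\<forall>i. orthogonal_matrix (S i)"
    then show "ls_obj A S \<le> ls_obj A (\<lambda>i. V $ i)" using V(2)[of "\<chi> i. S i"] by simp
  qed (use V in auto)
  then show ?thesis using that by blast
qed

subsection \<open>Dual certificates\<close>

lemma matrix_mult_diff_right: "A ** (B - C) = A ** B - A ** C" for A :: "real^'m^'k"
  by (simp add: matrix_matrix_mult_def vec_eq_iff right_diff_distrib sum_subtractf)

lemma matrix_mult_diff_left: "(A - B) ** C = A ** C - B ** C" for A :: "real^'m^'k"
  by (simp add: matrix_matrix_mult_def vec_eq_iff left_diff_distrib sum_subtractf)

lemma matrix_mult_add_left: "(A + B) ** C = A ** C + B ** C" for A :: "real^'m^'k"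
  by (simp add: matrix_matrix_mult_def vec_eq_iff distrib_right sum.distrib)

lemma matrix_mult_scaleR_left: "(c *\<^sub>R A) ** B = c *\<^sub>R (A ** B)" for A :: "real^'m^'k"
  by (simp add: matrix_matrix_mult_def vec_eq_iff sum_distrib_left mult_ac)

lemma matrix_mult_scaleR_right: "A ** (c *\<^sub>R B) = c *\<^sub>R (A ** B)" for A :: "real^'m^'k"
  by (simp add: matrix_matrix_mult_def vec_eq_iff sum_distrib_left mult_ac)

lemma transpose_diff: "transpose (A - B) = transpose A - transpose B"
  and transpose_scaleR: "transpose (c *\<^sub>R A) = c *\<^sub>R transpose A" for A :: "real^'m^'k"
  by (simp_all add: transpose_def vec_eq_iff)

text \<open>The dual certificate is \<open>block_diag L - A\<close>. Since it dominates \<open>\<kappa>\<close> times the orthogonal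
  projection \<open>P\<close> onto the complement of the columns of \<open>S\<close>, complementary slackness forces
  \<open>Y ** P = 0\<close>, and the diagonal block constraints then determine \<open>Y\<close>.\<close>

lemma sdp_maximizer_unique_if_certificate:
  fixes A :: "real^('n::finite \<times> 'd::finite)^('n \<times> 'd)"
  defines "n \<equiv> real CARD('n)"
  assumes orth: "\<And>i. orthogonal_matrix (R i)"
    and symA: "transpose A = A" and symL: "\<And>i. transpose (L i) = L i"
    and stationary: "block_diag L ** stack R = A ** stack R"
    and "\<kappa> > 0"
    and pos: "\<And>u. transpose (stack R) *v u = 0 \<Longrightarrow> \<kappa> * (u \<bullet> u) \<le> u \<bullet> ((block_diag L - A) *v u)"
  shows "sdp_maximizer A Y \<longleftrightarrow> Y = stack R ** transpose (stack R)"
proof -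
  define S where "S = stack R"
  define C where "C = block_diag L - A"
  define P where "P = mat 1 - (1 / n) *\<^sub>R (S ** transpose S)"
  have n: "n > 0" unfolding n_def by simp
  have StS: "transpose S ** S = n *\<^sub>R mat 1"
    unfolding S_def n_def by (rule transpose_stack_mult_stack[OF orth])
  have CS: "C ** S = 0" using stationary by (simp add: C_def S_def matrix_mult_diff_left)
  have symC: "transpose C = C"
    by (simp add: C_def transpose_diff symA transpose_block_diag symL)
  have symP: "transpose P = P"
    by (simp add: P_def transpose_diff transpose_scaleR matrix_transpose_mul)
  have StP: "transpose S ** P = 0"
    using n by (simp add: P_def matrix_mult_diff_right matrix_mult_scaleR_right matrix_mul_assoc StS
        matrix_mult_scaleR_left)
  have PP: "P ** P = P"
  proof -
    have "P ** P = P - (1 / n) *\<^sub>R (S ** (transpose S ** P))"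
      by (subst (1) P_def) (simp add: matrix_mult_diff_left matrix_mult_scaleR_left matrix_mul_assoc)
    then show ?thesis unfolding StP by (simp add: matrix_matrix_mult_def vec_eq_iff)
  qed
  have CP: "C ** P = C"
    by (simp add: P_def matrix_mult_diff_right matrix_mult_scaleR_right matrix_mul_assoc CS)
  have CPv: "C *v (P *v v) = C *v v" for v using CP by (metis matrix_vector_mul_assoc)
  have Pquad: "v \<bullet> (P *v v) = (P *v v) \<bullet> (P *v v)" for v
    by (metis PP inner_matrix_vector_transpose matrix_vector_mul_assoc symP)
  \<comment> \<open>\<open>pos\<close> is applied to \<open>P *v v\<close>. As \<open>C\<close>
    annihilates the columns of \<open>S\<close>, replacing \<open>v\<close> by \<open>P *v v\<close>
    does not change its form.\<close>
  have Cquad: "\<kappa> * (v \<bullet> (P *v v)) \<le> v \<bullet> (C *v v)" for v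
  proof -
    have "transpose S *v (P *v v) = 0" using StP by (simp add: matrix_vector_mul_assoc)
    then have "\<kappa> * (v \<bullet> (P *v v)) \<le> (P *v v) \<bullet> (C *v (P *v v))"
      using pos unfolding Pquad S_def C_def by blast
    also have "\<dots> = (P *v v) \<bullet> (C *v v)" by (simp add: CPv)
    also have "\<dots> = v \<bullet> (C *v v)"
      by (metis CPv inner_commute inner_matrix_vector_transpose symC)
    finally show ?thesis .
  qed
  have psdP: "psd P" unfolding psd_def using symP Pquad by simp
  have psdCP: "psd (C - \<kappa> *\<^sub>R P)"
    unfolding psd_def
    using Cquad
    by (simp add: transpose_diff transpose_scaleR symC symP matrix_vector_mult_diff_rdistrib
        inner_diff_right flip: scaleR_matrix_vector_assoc)
  \<comment> \<open>The diagonal block constraints make \<open>block_diag L \<bullet> X\<close>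
    equal to the constant \<open>\<tau>\<close>, so maximizing the objective means minimizing
    \<open>C \<bullet> X\<close>.\<close>
  define \<tau> where "\<tau> = (\<Sum>i\<in>UNIV. L i \<bullet> mat 1)"
  have obj: "C \<bullet> X = \<tau> - frob_inner A X" if "sdp_feasible X" for X
    using that by (simp add: C_def inner_diff_left block_diag_inner sdp_feasible_def \<tau>_def
        frob_inner_eq_inner)
  have CX: "0 \<le> P \<bullet> X" "\<kappa> * (P \<bullet> X) \<le> C \<bullet> X" if "sdp_feasible X" for X
    using psd_inner_nonneg[OF psdP, of X] psd_inner_nonneg[OF psdCP, of X] that
    by (auto simp: sdp_feasible_def inner_diff_left)
  have feas: "sdp_feasible (S ** transpose S)" unfolding S_def by (rule sdp_feasible_stack[OF orth])
  have "C \<bullet> (S ** transpose S) = 0"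
    using inner_matrix_mult_right[of S "transpose S" C] by (simp add: inner_commute CS)
  then have opt: "frob_inner A (S ** transpose S) = \<tau>" using obj[OF feas] by simp
  have "frob_inner A X \<le> \<tau>" if "sdp_feasible X" for X
  proof -
    have "0 \<le> \<kappa> * (P \<bullet> X)" using CX(1)[OF that] \<open>\<kappa> > 0\<close> by simp
    then show ?thesis using obj[OF that] CX(2)[OF that] by linarith
  qed
  then have max: "sdp_maximizer A (S ** transpose S)"
    using feas opt by (simp add: sdp_maximizer_def)
  have "Y = S ** transpose S" if "sdp_maximizer A Y"
  proof -
    have fY: "sdp_feasible Y" and "frob_inner A Y = \<tau>"
      using that max opt unfolding sdp_maximizer_def by force+
    then have "\<kappa> * (P \<bullet> Y) \<le> 0" using obj CX(2) by force
    then have PY: "P \<bullet> Y = 0" using CX(1)[OF fY] \<open>\<kappa> > 0\<close> by (simp add: mult_le_0_iff)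
    have psdY: "psd Y" using fY by (simp add: sdp_feasible_def)
    let ?c = "\<lambda>k. P *v axis k 1"
    \<comment> \<open>By \<open>P ** P = P\<close>, this is the trace of \<open>P Y P\<close>, a sum
      of nonnegative terms; each vanishes, and a psd form vanishes only on its kernel.\<close>
    have "P \<bullet> Y = (\<Sum>k\<in>UNIV. ?c k \<bullet> (Y *v ?c k))"
    proof -
      have "P \<bullet> Y = P \<bullet> (Y ** P)"
        using inner_matrix_mult_right[of P P Y] by (simp add: PP symP)
      then show ?thesis by (simp add: inner_matrix_columns[of P] matrix_vector_mul_assoc)
    qed
    then have "(\<Sum>k\<in>UNIV. ?c k \<bullet> (Y *v ?c k)) = 0" using PY by simp
    then have "\<forall>k\<in>UNIV. ?c k \<bullet> (Y *v ?c k) = 0"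
      using psdY by (intro sum_nonneg_eq_0_iff[THEN iffD1]) (auto simp: psd_def)
    then have "?c k \<bullet> (Y *v ?c k) = 0" for k by blast
    then have "Y *v ?c k = 0" for k by (rule psd_kernel[OF psdY])
    then have "(Y ** P) *v axis k 1 = 0" for k by (simp add: matrix_vector_mul_assoc)
    then have "Y ** P = 0"
      by (simp add: matrix_vector_mult_basis column_def vec_eq_iff)
    then have Y1: "Y = (1 / n) *\<^sub>R (Y ** S ** transpose S)"
      by (simp add: P_def matrix_mult_diff_right matrix_mult_scaleR_right matrix_mul_assoc)
    \<comment> \<open>Combining \<open>Y = Y S S^T / n\<close> with its transpose sandwiches
      \<open>Y\<close> between projections onto the columns of \<open>S\<close>, which gives
      \<open>Y = S K S^T\<close>.\<close>
    define K where "K = (1 / n) *\<^sub>R ((1 / n) *\<^sub>R (transpose S ** Y ** S))"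
    have symY: "transpose Y = Y" using psdY by (simp add: psd_def)
    have "Y = transpose ((1 / n) *\<^sub>R (Y ** S ** transpose S))"
      by (rule trans[OF symY[symmetric] arg_cong[OF Y1, of transpose]])
    also have "\<dots> = (1 / n) *\<^sub>R (S ** transpose S ** Y)"
      by (simp add: transpose_scaleR matrix_transpose_mul symY matrix_mul_assoc)
    finally have "(1 / n) *\<^sub>R (Y ** S ** transpose S)
        = (1 / n) *\<^sub>R (((1 / n) *\<^sub>R (S ** transpose S ** Y)) ** S ** transpose S)"
      by (rule arg_cong)
    with Y1 have "Y = (1 / n) *\<^sub>R (((1 / n) *\<^sub>R (S ** transpose S ** Y)) ** S ** transpose S)"
      by (rule trans)
    also have "\<dots> = S ** K ** transpose S"
      by (simp only: K_def matrix_mult_scaleR_right matrix_mult_scaleR_left matrix_mul_assoc)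
    finally have YK: "Y = S ** K ** transpose S" .
    \<comment> \<open>A single diagonal block determines \<open>K\<close>: conjugating
      \<open>R i ** K ** transpose (R i) = mat 1\<close> by the orthogonal \<open>R i\<close> gives
      \<open>K = mat 1\<close>.\<close>
    fix i :: 'n
    have "mat 1 = blk Y i i" using fY by (simp add: sdp_feasible_def)
    also have "\<dots> = R i ** K ** transpose (R i)"
      by (subst YK) (simp add: blk_mult_transpose block_matrix_mult S_def)
    finally have "R i ** K ** transpose (R i) = mat 1" by simp
    then have "transpose (R i) ** (R i ** K ** transpose (R i)) ** R i = transpose (R i) ** R i"
      by simp
    moreover have "transpose (R i) ** (R i ** K ** transpose (R i)) ** R i
        = (transpose (R i) ** R i) ** K ** (transpose (R i) ** R i)"
      by (simp add: matrix_mul_assoc)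
    moreover have "transpose (R i) ** R i = mat 1"
      using orth by (simp add: orthogonal_matrix)
    ultimately have "K = mat 1" by simp
    then show ?thesis using YK by simp
  qed
  then show ?thesis using max unfolding S_def by blast
qed

text \<open>Only block \<open>i\<close> is varied, to \<open>Q ** R i\<close>. Because
  \<open>A_ii = I\<close>, the second order term is \<open>|Q - I|^2 = 2 tr I - 2 tr Q\<close>,
  affine in \<open>Q\<close>; absorbing it into the linear term shows that the identity is optimal
  for \<open>L - mat 1\<close>, so even \<open>L \<ge> I\<close> holds.\<close>

lemma ls_maximizer_multiplier_psd:
  fixes A :: "real^('n::finite \<times> 'd::finite)^('n \<times> 'd)"
  assumes max: "ls_maximizer A R" and symA: "transpose A = A" and diag: "blk A i i = mat 1"
  shows "psd (block (A ** stack R) i ** transpose (R i))"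
proof -
  define L where "L = block (A ** stack R) i ** transpose (R i)"
  have orth: "orthogonal_matrix (R j)" for j using max by (simp add: ls_maximizer_def)
  have RRt: "R i ** transpose (R i) = mat 1" and RtR: "transpose (R i) ** R i = mat 1"
    using orth by (simp_all add: orthogonal_matrix_def)
  have LR: "L ** R i = block (A ** stack R) i"
    by (simp add: L_def RtR flip: matrix_mul_assoc)
  have "psd (L - mat 1)"
  proof (rule psd_if_identity_maximizes_inner)
    fix Q :: "real^'d^'d" assume Q: "orthogonal_matrix Q"
    define R' where "R' = R(i := Q ** R i)"
    define E where "E = stack R' - stack R"
    define G where "G = (Q - mat 1) ** R i"
    have E: "block E j = (if j = i then G else 0)" for j
      by (simp add: E_def block_diff R'_def G_def matrix_mult_diff_left)
    have EX: "E \<bullet> X = G \<bullet> block X i" for X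
      by (simp add: inner_block[of E] E if_distrib[of "\<lambda>t. t \<bullet> _"] cong: if_cong)
    have "block (A ** E) i = (\<Sum>j\<in>UNIV. if j = i then blk A i i ** G else 0)"
      unfolding block_blk_mult by (intro sum.cong) (auto simp: E)
    then have AE: "block (A ** E) i = G" by (simp add: diag)
    have "ls_obj A R' \<le> ls_obj A R"
      using max Q orth by (auto simp: ls_maximizer_def R'_def orthogonal_matrix_mul)
    moreover have "stack R' = stack R + E" by (simp add: E_def)
    moreover have "stack R \<bullet> (A ** E) = E \<bullet> (A ** stack R)"
      using inner_matrix_mult_left[of A E "stack R"] symA by (simp add: inner_commute)
    ultimately have "2 * (E \<bullet> (A ** stack R)) + E \<bullet> (A ** E) \<le> 0"
      by (simp add: ls_obj_eq_inner matrix_add_ldistrib inner_add_left inner_add_right)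
    then have "2 * (G \<bullet> (L ** R i)) + G \<bullet> G \<le> 0" by (simp add: EX AE LR)
    moreover have "G \<bullet> (X ** R i) = (Q - mat 1) \<bullet> X" for X
      by (simp add: G_def inner_matrix_mult_right RRt flip: matrix_mul_assoc)
    ultimately have "2 * ((Q - mat 1) \<bullet> L) + (Q - mat 1) \<bullet> (Q - mat 1) \<le> 0"
      by (metis G_def)
    moreover have "Q \<bullet> Q = mat 1 \<bullet> (mat 1 :: real^'d^'d)"
      using inner_matrix_mult_left[of Q "mat 1" Q] Q by (simp add: orthogonal_matrix)
    ultimately show "Q \<bullet> (L - mat 1) \<le> mat 1 \<bullet> (L - mat 1)"
      by (simp add: inner_diff_left inner_diff_right inner_commute)
  qed
  then have "transpose L = L" and ge: "v \<bullet> v \<le> v \<bullet> (L *v v)" for v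
    by (auto simp: psd_def transpose_diff matrix_vector_mult_diff_rdistrib inner_diff_right)
  moreover have "0 \<le> v \<bullet> (L *v v)" for v by (rule order_trans[OF inner_ge_zero ge])
  ultimately show ?thesis unfolding L_def psd_def by blast
qed

subsection \<open>Distance of a least squares maximizer to the ground truth\<close>

text \<open>The pointwise identity is kept as a conclusion because it turns a bound on
  \<open>stack R - Zmat\<close> into a lower bound on the form of
  \<open>transpose Zmat ** stack R\<close>.\<close>

lemma ls_maximizer_proximity:
  fixes D :: "real^('n::finite \<times> 'd::finite)^('n \<times> 'd)"
  defines "n \<equiv> real CARD('n)" and "d \<equiv> real CARD('d)"
  assumes max: "ls_maximizer (Zmat ** transpose Zmat + D) R" and symD: "transpose D = D"
    and psdM: "psd (transpose Zmat ** stack R)"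
  shows "norm (stack R - Zmat) = 0 \<or> norm (stack R - Zmat) < 4 * sqrt (d / n) * op_norm D"
    and "(stack R *v x - Zmat *v x) \<bullet> (stack R *v x - Zmat *v x)
      = 2 * n * (x \<bullet> x) - 2 * (x \<bullet> ((transpose Zmat ** stack R) *v x))"
proof -
  define S where "S = stack R"
  define Z where "Z = (Zmat :: real^'d^('n \<times> 'd))"
  define M where "M = transpose Z ** S"
  define e where "e = norm (S - Z)"
  have n: "n > 0" unfolding n_def by simp
  have orth: "orthogonal_matrix (R i)" for i using max by (simp add: ls_maximizer_def)
  have Z_stack: "Z = stack (\<lambda>_. mat 1)" unfolding Z_def by (rule Zmat_eq_stack)
  have SS: "(S *v x) \<bullet> (S *v x) = n * (x \<bullet> x)" for x
    unfolding S_def n_def by (rule inner_stack_vector[OF orth])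
  have ZZ: "(Z *v x) \<bullet> (Z *v x) = n * (x \<bullet> x)" for x
    unfolding Z_stack n_def by (rule inner_stack_vector) (rule orthogonal_matrix_id)
  have ZS: "(Z *v x) \<bullet> (S *v x) = x \<bullet> (M *v x)" for x
    by (metis M_def inner_commute inner_matrix_vector_transpose matrix_vector_mul_assoc)
  have quad: "(S *v x - Z *v x) \<bullet> (S *v x - Z *v x) = 2 * n * (x \<bullet> x) - 2 * (x \<bullet> (M *v x))" for x
    by (simp add: inner_diff_left inner_diff_right SS ZZ ZS inner_commute[of "S *v x"])
  then show "(stack R *v x - Zmat *v x) \<bullet> (stack R *v x - Zmat *v x)
      = 2 * n * (x \<bullet> x) - 2 * (x \<bullet> ((transpose Zmat ** stack R) *v x))"
    unfolding S_def Z_def M_def .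
  have "x \<bullet> (M *v x) \<le> n * (x \<bullet> x)" for x
    using quad[of x] inner_ge_zero[of "S *v x - Z *v x"] by linarith
  \<comment> \<open>With \<open>0 \<le> M \<le> n I\<close>, the squared norm is bounded linearly by
    the trace, and the trace deficit \<open>n d - tr M\<close> is exactly
    \<open>e^2 / 2\<close>.\<close>
  then have normM: "(norm M)\<^sup>2 \<le> n * (mat 1 \<bullet> M)"
    using psdM unfolding M_def Z_def S_def by (intro norm_square_psd_le)
  have nS: "S \<bullet> S = n * d" and nZ: "Z \<bullet> Z = n * d"
    using norm_stack[OF orth] norm_stack[OF orthogonal_matrix_id]
    by (simp_all add: power2_norm_eq_inner S_def Z_stack n_def d_def)
  have SZ: "S \<bullet> Z = mat 1 \<bullet> M"
    using inner_matrix_mult_left[of Z "mat 1" S] by (simp add: M_def inner_commute)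
  have e2: "e\<^sup>2 = 2 * n * d - 2 * (mat 1 \<bullet> M)"
    unfolding e_def power2_norm_eq_inner
    by (simp add: inner_diff_left inner_diff_right nS nZ SZ inner_commute[of Z S])
  have sum2: "(norm (S + Z))\<^sup>2 = 4 * n * d - e\<^sup>2"
    unfolding e2 power2_norm_eq_inner
    by (simp add: inner_add_left inner_add_right nS nZ SZ inner_commute[of Z S])
  have obj: "ls_obj (Z ** transpose Z + D) T = (norm (transpose Z ** stack T))\<^sup>2 + stack T \<bullet> (D ** stack T)" for T
  proof -
    have "stack T \<bullet> (Z ** (transpose Z ** stack T)) = (norm (transpose Z ** stack T))\<^sup>2"
      using inner_matrix_mult_left[of Z "transpose Z ** stack T" "stack T"]
      by (simp add: power2_norm_eq_inner inner_commute)
    then show ?thesis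
      by (simp add: ls_obj_eq_inner matrix_mult_add_left inner_add_right matrix_mul_assoc)
  qed
  have "ls_obj (Z ** transpose Z + D) (\<lambda>_. mat 1) \<le> ls_obj (Z ** transpose Z + D) R"
    using max by (simp add: ls_maximizer_def Z_def orthogonal_matrix_id)
  then have "(norm (transpose Z ** Z))\<^sup>2 + Z \<bullet> (D ** Z) \<le> (norm M)\<^sup>2 + S \<bullet> (D ** S)"
    unfolding obj M_def S_def by (simp only: Z_stack[symmetric])
  moreover have "(norm (transpose Z ** Z))\<^sup>2 = n * (n * d)"
  proof -
    have "transpose Z ** Z = n *\<^sub>R mat 1"
      unfolding Z_stack n_def by (rule transpose_stack_mult_stack) (rule orthogonal_matrix_id)
    then show ?thesis
      unfolding power2_norm_eq_inner by (simp add: d_def inner_matrix_columns inner_axis_axis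
          flip: scaleR_matrix_vector_assoc)
  qed
  moreover have "S \<bullet> (D ** S) - Z \<bullet> (D ** Z) = (S - Z) \<bullet> (D ** (S + Z))"
  proof -
    have "S \<bullet> (D ** Z) = Z \<bullet> (D ** S)"
      using inner_matrix_mult_left[of D Z S] symD by (simp add: inner_commute)
    then show ?thesis by (simp add: inner_diff_left inner_add_right matrix_add_ldistrib)
  qed
  moreover have "(S - Z) \<bullet> (D ** (S + Z)) \<le> e * (op_norm D * norm (S + Z))"
    unfolding e_def
    by (meson mult_left_mono norm_cauchy_schwarz norm_ge_zero norm_matrix_mult_le_op_norm order_trans)
  ultimately have "n * (n * d) - n * (mat 1 \<bullet> M) \<le> e * (op_norm D * norm (S + Z))"
    using normM by linarith
  moreover have "n * (n * d) - n * (mat 1 \<bullet> M) = n * e\<^sup>2 / 2"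
    unfolding e2 by (simp add: algebra_simps)
  ultimately have main: "e * (n * e) \<le> e * (2 * op_norm D * norm (S + Z))"
    by (simp add: power2_eq_square algebra_simps)
  have "e < 4 * sqrt (d / n) * op_norm D" if "e \<noteq> 0"
  proof -
    have e: "e > 0" using that unfolding e_def by simp
    then have le: "n * e \<le> 2 * op_norm D * norm (S + Z)" using main by simp
    moreover have "n * e > 0" using n e by simp
    ultimately have "op_norm D * norm (S + Z) > 0" by linarith
    \<comment> \<open>The strict bound on \<open>norm (S + Z)\<close> below is multiplied by
      \<open>op_norm D\<close>, so strictness survives only if this factor is positive.\<close>
    then have D: "op_norm D > 0" using op_norm_nonneg[of D] by (auto simp: zero_less_mult_iff)
    have "norm (S + Z) < 2 * sqrt (n * d)"
    proof (rule power2_less_imp_less)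
      show "(norm (S + Z))\<^sup>2 < (2 * sqrt (n * d))\<^sup>2"
        using e n by (simp add: sum2 power_mult_distrib d_def)
    qed (simp add: n_def d_def)
    also have "sqrt (n * d) = n * sqrt (d / n)"
      using n by (simp add: real_sqrt_mult real_sqrt_divide field_simps)
    finally have "2 * op_norm D * norm (S + Z) < 2 * op_norm D * (2 * (n * sqrt (d / n)))"
      using D by simp
    then have "n * e < n * (4 * sqrt (d / n) * op_norm D)" using le by (simp add: algebra_simps)
    then show ?thesis using n by simp
  qed
  then show "norm (stack R - Zmat) = 0 \<or> norm (stack R - Zmat) < 4 * sqrt (d / n) * op_norm D"
    unfolding e_def S_def Z_def by blast
qed

section \<open>Rotation invariance and lower bounds for the certificate\<close>

lemma transpose_Delta_i_mult: "transpose (Delta_i D i) ** T = block (D ** T) i"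
  by (simp add: block_def Delta_i_def transpose_def matrix_matrix_mult_def vec_eq_iff)

lemma block_Zmat_gram: "block (Zmat ** transpose Zmat ** T) i = transpose Zmat ** T"
  by (simp add: block_matrix_mult flip: matrix_mul_assoc)

text \<open>A common right factor cancels in the Gram matrix. This freedom allows a maximizer to be
  aligned with \<open>Zmat\<close> by a polar factor.\<close>

lemma ls_maximizer_mult_orthogonal:
  fixes A :: "real^('n::finite \<times> 'd::finite)^('n \<times> 'd)"
  assumes "ls_maximizer A R" and Q: "orthogonal_matrix Q"
  shows "ls_maximizer A (\<lambda>i. R i ** Q)"
    and "stack (\<lambda>i. R i ** Q) ** transpose (stack (\<lambda>i. R i ** Q)) = stack R ** transpose (stack R)"
proof -
  have "stack (\<lambda>i. R i ** Q) = stack R ** Q"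
    by (rule block_eqI) (simp add: block_matrix_mult)
  then have "stack (\<lambda>i. R i ** Q) ** transpose (stack (\<lambda>i. R i ** Q))
      = stack R ** (Q ** transpose Q) ** transpose (stack R)"
    by (simp add: matrix_transpose_mul matrix_mul_assoc)
  then show eq: "stack (\<lambda>i. R i ** Q) ** transpose (stack (\<lambda>i. R i ** Q)) = stack R ** transpose (stack R)"
    using Q by (simp add: orthogonal_matrix_def)
  show "ls_maximizer A (\<lambda>i. R i ** Q)"
    using assms unfolding ls_maximizer_def frob_inner_stack[symmetric] eq
    by (simp add: orthogonal_matrix_mul)
qed

text \<open>The multiplier is psd, so a lower bound on \<open>norm (L *v y)\<close> suffices. With
  \<open>x = transpose (R i) *v y\<close>, of the same norm as \<open>y\<close>, the vector is
  \<open>M *v x\<close> perturbed by \<open>V Z x\<close> and \<open>V (S - Z) x\<close>, and the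
  triangle inequality applies.\<close>

lemma block_multiplier_lower_bound:
  fixes D :: "real^('n::finite \<times> 'd::finite)^('n \<times> 'd)" and R :: "'n \<Rightarrow> real^'d^'d" and i :: 'n
  defines "A \<equiv> Zmat ** transpose Zmat + D"
    and "S \<equiv> stack R" and "Z \<equiv> (Zmat :: real^'d^('n \<times> 'd))"
  defines "c \<equiv> real CARD('n) - (norm (S - Z))\<^sup>2 / 2
      - op_norm (transpose (Delta_i D i) ** Z) - op_norm (Delta_i D i) * norm (S - Z)"
  assumes max: "ls_maximizer A R" and symD: "transpose D = D"
    and psdM: "psd (transpose Z ** S)"
    and psdL: "psd (block (A ** S) i ** transpose (R i))" and "c > 0"
  shows "c * (x \<bullet> x) \<le> x \<bullet> ((block (A ** S) i ** transpose (R i)) *v x)"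
proof (rule psd_lower_bound[OF psdL \<open>c > 0\<close>])
  fix y
  define M where "M = transpose Z ** S"
  define e where "e = norm (S - Z)"
  define x where "x = transpose (R i) *v y"
  define V where "V = transpose (Delta_i D i)"
  have "orthogonal_matrix (transpose (R i))" using max by (simp add: ls_maximizer_def)
  then have nx: "norm x = norm y"
    unfolding x_def by (simp add: norm_eq_sqrt_inner inner_matrix_vector_transpose
        matrix_vector_mul_assoc orthogonal_matrix_def)
  have diff: "norm (S *v x - Z *v x) \<le> e * norm x"
    unfolding e_def by (metis matrix_vector_mult_diff_rdistrib norm_matrix_vector_le_norm)
  \<comment> \<open>Half of \<open>|S x - Z x|^2\<close> equals \<open>n |x|^2 - x M x\<close> and
    is at most \<open>e^2 |x|^2 / 2\<close>.\<close>
  have "(real CARD('n) - e\<^sup>2 / 2) * (norm x)\<^sup>2 \<le> x \<bullet> (M *v x)"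
  proof -
    have "(norm (S *v x - Z *v x))\<^sup>2 = 2 * real CARD('n) * (x \<bullet> x) - 2 * (x \<bullet> (M *v x))"
      using ls_maximizer_proximity(2)[OF max[unfolded A_def] symD psdM[unfolded S_def Z_def], of x]
      by (simp add: M_def S_def Z_def power2_norm_eq_inner)
    moreover have "(norm (S *v x - Z *v x))\<^sup>2 \<le> e\<^sup>2 * (norm x)\<^sup>2"
      using power_mono[OF diff, of 2] by (simp add: power_mult_distrib)
    ultimately show ?thesis by (simp add: power2_norm_eq_inner algebra_simps)
  qed
  also have "\<dots> \<le> norm x * norm (M *v x)" by (rule norm_cauchy_schwarz)
  finally have "norm x * ((real CARD('n) - e\<^sup>2 / 2) * norm x) \<le> norm x * norm (M *v x)"
    by (simp add: power2_eq_square algebra_simps)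
  then have Mx: "(real CARD('n) - e\<^sup>2 / 2) * norm x \<le> norm (M *v x)"
    by (cases "x = 0") auto
  have blockAS: "block (A ** S) i = M + V ** S"
    by (simp add: A_def M_def Z_def V_def matrix_mult_add_left block_add block_Zmat_gram
        transpose_Delta_i_mult)
  have "(block (A ** S) i ** transpose (R i)) *v y = (M + V ** S) *v x"
    by (simp add: x_def matrix_vector_mul_assoc blockAS)
  also have "\<dots> = M *v x + ((V ** Z) *v x + V *v (S *v x - Z *v x))"
    by (simp add: matrix_vector_mult_add_rdistrib matrix_vector_mult_diff_distrib matrix_vector_mul_assoc)
  finally have eq: "(block (A ** S) i ** transpose (R i)) *v y = M *v x + ((V ** Z) *v x + V *v (S *v x - Z *v x))" .
  have "norm (V *v (S *v x - Z *v x)) \<le> op_norm (Delta_i D i) * (e * norm x)"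
    unfolding V_def
    by (meson diff mult_left_mono norm_transpose_vector_le_op_norm op_norm_nonneg order_trans)
  moreover have "norm ((V ** Z) *v x) \<le> op_norm (V ** Z) * norm x"
    by (rule norm_matrix_vector_le_op_norm)
  moreover have "norm (M *v x) \<le> norm (M *v x + ((V ** Z) *v x + V *v (S *v x - Z *v x)))
      + (norm ((V ** Z) *v x) + norm (V *v (S *v x - Z *v x)))"
    using norm_triangle_ineq4[of "M *v x + ((V ** Z) *v x + V *v (S *v x - Z *v x))"
        "(V ** Z) *v x + V *v (S *v x - Z *v x)"]
      norm_triangle_ineq[of "(V ** Z) *v x" "V *v (S *v x - Z *v x)"] by simp
  ultimately have "(real CARD('n) - e\<^sup>2 / 2) * norm x - op_norm (V ** Z) * norm x
      - op_norm (Delta_i D i) * (e * norm x) \<le> norm ((block (A ** S) i ** transpose (R i)) *v y)"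
    using Mx unfolding eq by linarith
  then show "c * norm y \<le> norm ((block (A ** S) i ** transpose (R i)) *v y)"
    unfolding c_def V_def e_def nx by (simp add: algebra_simps)
qed

text \<open>For \<open>D = 0\<close> the inequality \<open>cond\<close> only says
  \<open>g \<le> n\<close>, without slack; \<open>g0\<close> supplies the strictness in that
  case.\<close>

lemma sdp_maximizer_iff_ls_gram:
  fixes D :: "real^('n::finite \<times> 'd::finite)^('n \<times> 'd)"
  assumes symD: "transpose D = D"
    and diag: "\<And>i. blk D i i = 0"
    and cond: "24 * real CARD('d) * (op_norm D)\<^sup>2 / real CARD('n)
      + 4 * sqrt (real CARD('d) / real CARD('n)) * op_norm D * b + g + op_norm D \<le> real CARD('n)"
    and b: "\<And>i. op_norm (Delta_i D i) \<le> b"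
    and g: "\<And>i. op_norm (transpose (Delta_i D i) ** (Zmat :: real^'d^('n \<times> 'd))) \<le> g"
    and g0: "D = 0 \<Longrightarrow> g = 0"
    and max: "ls_maximizer (Zmat ** transpose Zmat + D) R"
  shows "sdp_maximizer (Zmat ** transpose Zmat + D) Y \<longleftrightarrow> Y = stack R ** transpose (stack R)"
proof -
  define A where "A = Zmat ** transpose Zmat + D"
  define Z where "Z = (Zmat :: real^'d^('n \<times> 'd))"
  obtain Q where Q: "orthogonal_matrix Q" "psd ((transpose Z ** stack R) ** Q)"
    by (rule exists_orthogonal_psd_mult)
  \<comment> \<open>Rotating by \<open>Q\<close> aligns the stack with \<open>Z\<close> and keeps
    its Gram matrix, so a certificate built for \<open>R'\<close> settles the claim for
    \<open>R\<close>.\<close>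
  define R' where "R' = (\<lambda>i. R i ** Q)"
  define S where "S = stack R'"
  define n d t e where "n = real CARD('n)" and "d = real CARD('d)" and "t = op_norm D"
    and "e = norm (S - Z)"
  have max': "ls_maximizer A R'" and gram: "S ** transpose S = stack R ** transpose (stack R)"
    using ls_maximizer_mult_orthogonal[OF max Q(1)] unfolding A_def S_def R'_def by auto
  have "S = stack R ** Q" unfolding S_def R'_def by (rule block_eqI) (simp add: block_matrix_mult)
  then have psdM: "psd (transpose Z ** S)" using Q(2) by (simp add: matrix_mul_assoc)
  have orth: "orthogonal_matrix (R' i)" for i using max' by (simp add: ls_maximizer_def)
  have symA: "transpose A = A"
    using symD psd_gram[of "Zmat :: real^'d^('n \<times> 'd)"]
    by (simp add: A_def psd_def transpose_def vec_eq_iff)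
  have diagA: "blk A i i = mat 1" for i
  proof -
    have "blk A i i = blk (Zmat ** transpose Zmat) i i + blk D i i"
      by (simp add: A_def blk_def vec_eq_iff)
    then show ?thesis by (simp add: diag blk_mult_transpose transpose_mat)
  qed
  have n: "n > 0" and d: "d > 0" unfolding n_def d_def by simp_all
  have b0: "b \<ge> 0" using b op_norm_nonneg order_trans by blast
  have t0: "t \<ge> 0" unfolding t_def by (rule op_norm_nonneg)
  have e0: "e \<ge> 0" unfolding e_def by simp
  have prox: "e = 0 \<or> e < 4 * sqrt (d / n) * t"
    using ls_maximizer_proximity(1)[OF max'[unfolded A_def] symD] psdM
    unfolding e_def S_def Z_def n_def d_def t_def by blast
  \<comment> \<open>The factor \<open>3 / 2\<close> collects \<open>e^2 / 2\<close> lost in the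
    blocks \<open>L i\<close> and \<open>e^2\<close> from \<open>Z Z^T\<close> on the kernel of
    \<open>S^T\<close>.\<close>
  define \<kappa> where "\<kappa> = n - 3 / 2 * e\<^sup>2 - g - b * e - t"
  have \<kappa>: "\<kappa> > 0"
  proof (cases "t = 0")
    case True
    have "D *v v = 0" for v using norm_matrix_vector_le_op_norm[of D v] True by (simp add: t_def)
    then have "D = 0" by (simp add: matrix_eq)
    moreover have "e = 0" using prox e0 True by auto
    ultimately show ?thesis using True n g0 by (simp add: \<kappa>_def)
  next
    case False
    define r where "r = 4 * sqrt (d / n) * t"
    have "r > 0" using False t0 n d by (simp add: r_def)
    then have er: "e < r" using prox unfolding r_def by auto
    \<comment> \<open>Hence \<open>3 / 2 * r^2\<close> is the first term \<open>24 d t^2 / n\<close>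
      of \<open>cond\<close>, and \<open>b * r\<close> is the second; \<open>e < r\<close> then
      makes \<open>\<kappa>\<close> strictly positive.\<close>
    have "r\<^sup>2 = 16 * (d / n) * t\<^sup>2" using n d by (simp add: r_def power_mult_distrib)
    then have "3 / 2 * r\<^sup>2 + b * r + g + t \<le> n"
      using cond by (simp add: n_def d_def t_def r_def algebra_simps)
    moreover have "e\<^sup>2 < r\<^sup>2" using er e0 by (intro power_strict_mono) auto
    moreover have "b * e \<le> b * r" using er b0 by (intro mult_left_mono) auto
    ultimately show ?thesis unfolding \<kappa>_def by linarith
  qed
  define L where "L = (\<lambda>i. block (A ** S) i ** transpose (R' i))"
  have psdL: "psd (L i)" for i
    unfolding L_def S_def by (rule ls_maximizer_multiplier_psd[OF max' symA diagA])
  have L_lower: "(n - e\<^sup>2 / 2 - g - b * e) * (x \<bullet> x) \<le> x \<bullet> (L i *v x)" for i x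
  proof -
    let ?c = "n - e\<^sup>2 / 2 - op_norm (transpose (Delta_i D i) ** Z) - op_norm (Delta_i D i) * e"
    have "op_norm (Delta_i D i) * e \<le> b * e" using b e0 by (rule mult_right_mono)
    then have c: "n - e\<^sup>2 / 2 - g - b * e \<le> ?c" using g[of i] unfolding Z_def by linarith
    moreover have "e\<^sup>2 \<ge> 0" by simp
    ultimately have "?c > 0" using \<kappa> t0 unfolding \<kappa>_def by linarith
    then have "?c * (x \<bullet> x) \<le> x \<bullet> (L i *v x)"
      unfolding L_def n_def e_def S_def Z_def A_def
      using max' symD psdM psdL[of i] unfolding L_def S_def Z_def A_def
      by (intro block_multiplier_lower_bound)
    then show ?thesis using mult_right_mono[OF c inner_ge_zero[of x]] by linarith
  qed
  have "sdp_maximizer A Y \<longleftrightarrow> Y = stack R' ** transpose (stack R')"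
  proof (rule sdp_maximizer_unique_if_certificate[where L = L and \<kappa> = \<kappa>, OF orth symA _ _ \<kappa>])
    show "transpose (L i) = L i" for i using psdL by (simp add: psd_def)
    show "block_diag L ** stack R' = A ** stack R'"
    proof (rule block_eqI)
      fix i
      have "transpose (R' i) ** R' i = mat 1" using orth by (simp add: orthogonal_matrix)
      then show "block (block_diag L ** stack R') i = block (A ** stack R') i"
        by (simp add: block_block_diag_mult L_def S_def flip: matrix_mul_assoc)
    qed
    fix u assume u: "transpose (stack R') *v u = 0"
    have "(n - e\<^sup>2 / 2 - g - b * e) * (u \<bullet> u) \<le> u \<bullet> (block_diag L *v u)"
      by (simp add: inner_block[of u] block_block_diag_vector sum_distrib_left sum_mono L_lower)
    moreover have "u \<bullet> (A *v u) \<le> e\<^sup>2 * (u \<bullet> u) + t * (u \<bullet> u)"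
    proof -
      \<comment> \<open>On the kernel of \<open>S^T\<close> the signal part \<open>Z Z^T\<close> of
        \<open>A\<close> is seen only through the error \<open>S - Z\<close>.\<close>
      have "transpose Z *v u = - (transpose (S - Z) *v u)"
        using u by (simp add: transpose_diff matrix_vector_mult_diff_rdistrib S_def)
      then have "norm (transpose Z *v u) \<le> e * norm u"
        using norm_matrix_vector_le_norm[of "transpose (S - Z)" u]
        by (simp add: norm_transpose e_def)
      then have "(norm (transpose Z *v u))\<^sup>2 \<le> e\<^sup>2 * (u \<bullet> u)"
        using power_mono[of "norm (transpose Z *v u)" _ 2]
        by (fastforce simp: power_mult_distrib power2_norm_eq_inner)
      moreover have "u \<bullet> (D *v u) \<le> t * (u \<bullet> u)"
      proof -
        have "u \<bullet> (D *v u) \<le> norm u * (t * norm u)" unfolding t_def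
          by (meson mult_left_mono norm_cauchy_schwarz norm_ge_zero norm_matrix_vector_le_op_norm order_trans)
        then show ?thesis by (simp add: power2_norm_eq_inner[symmetric] power2_eq_square mult_ac)
      qed
      moreover have "u \<bullet> (A *v u) = (norm (transpose Z *v u))\<^sup>2 + u \<bullet> (D *v u)"
        unfolding power2_norm_eq_inner
        by (simp add: A_def Z_def matrix_vector_mult_add_rdistrib inner_add_right
            inner_matrix_vector_transpose[of u Zmat] flip: matrix_vector_mul_assoc)
      ultimately show ?thesis by linarith
    qed
    ultimately show "\<kappa> * (u \<bullet> u) \<le> u \<bullet> ((block_diag L - A) *v u)"
      by (simp add: \<kappa>_def matrix_vector_mult_diff_rdistrib inner_diff_right algebra_simps)
  qed
  then show ?thesis using gram unfolding A_def S_def by simp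
qed

theorem theorem1:
  fixes \<Delta> :: "real^('n::finite \<times> 'd::finite)^('n \<times> 'd)"
    and A :: "real^('n \<times> 'd)^('n \<times> 'd)"
  defines "\<delta> \<equiv> (4::real)"
  assumes sym: "transpose \<Delta> = \<Delta>"
    and diag: "\<forall>i. blk \<Delta> i i = 0"
    and A_def: "A = (Zmat :: real^'d^('n \<times> 'd)) ** transpose Zmat + \<Delta>"
    and cond: "real CARD('n) \<ge>
        3 * \<delta>^2 * real CARD('d) * (op_norm \<Delta>)^2 / (2 * real CARD('n))
      + \<delta> * sqrt (real CARD('d) / real CARD('n)) * op_norm \<Delta>
          * Max (range (\<lambda>i. op_norm (Delta_i \<Delta> i)))
      + Max (range (\<lambda>i. op_norm (transpose (Delta_i \<Delta> i) ** (Zmat :: real^'d^('n \<times> 'd)))))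
      + op_norm \<Delta>"
  shows "\<exists>X. (\<forall>Y. sdp_maximizer A Y \<longleftrightarrow> Y = X)
           \<and> rank X = CARD('d)
           \<and> (\<exists>R. ls_maximizer A R \<and> X = stack R ** transpose (stack R))
           \<and> (\<forall>R. ls_maximizer A R \<longrightarrow> stack R ** transpose (stack R) = X)"
proof -
  let ?b = "Max (range (\<lambda>i. op_norm (Delta_i \<Delta> i)))"
  let ?g = "Max (range (\<lambda>i. op_norm (transpose (Delta_i \<Delta> i) ** (Zmat :: real^'d^('n \<times> 'd)))))"
  have unique: "sdp_maximizer A Y \<longleftrightarrow> Y = stack R ** transpose (stack R)"
    if "ls_maximizer A R" for R Y
    unfolding A_def
  proof (rule sdp_maximizer_iff_ls_gram[where b = ?b and g = ?g])
    \<comment> \<open>The constant is \<open>3 * 4^2 / 2 = 24\<close>.\<close>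
    show "24 * real CARD('d) * (op_norm \<Delta>)\<^sup>2 / real CARD('n)
      + 4 * sqrt (real CARD('d) / real CARD('n)) * op_norm \<Delta> * ?b + ?g + op_norm \<Delta> \<le> real CARD('n)"
      using cond unfolding \<delta>_def by simp
    show "?g = 0" if "\<Delta> = 0"
    proof -
      have "transpose (Delta_i \<Delta> i) ** (Zmat :: real^'d^('n \<times> 'd)) = 0" for i
        unfolding transpose_Delta_i_mult that
        by (simp add: block_def matrix_matrix_mult_def vec_eq_iff)
      then show ?thesis by (simp add: op_norm_def onorm_zero)
    qed
  qed (use sym diag that in \<open>auto simp: A_def intro!: Max_ge\<close>)
  obtain R where R: "ls_maximizer A R" by (rule exists_ls_maximizer)
  define X where "X = stack R ** transpose (stack R)"
  have "sdp_maximizer A Y \<longleftrightarrow> Y = X" for Y unfolding X_def by (rule unique[OF R])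
  \<comment> \<open>Every least squares maximizer yields an SDP maximizer, so uniqueness of the
    latter makes all their Gram matrices equal.\<close>
  moreover from this have "stack T ** transpose (stack T) = X" if "ls_maximizer A T" for T
    using unique[OF that] by blast
  moreover have "rank X = CARD('d)"
    unfolding X_def using R by (intro rank_stack_gram) (simp add: ls_maximizer_def)
  ultimately show ?thesis using R X_def by blast
qed

end
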